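(* Let $\alpha\in(0,1/2)$ be irrational with continued fraction expansion $\alpha=[0;a_1,a_2,\ldots]$ and let $(q_k)_{k\ge0}$ be the denominators of its convergents. If $m$ is the minimum abelian period of a nonempty factor of a Sturmian word of slope $\alpha$, then either $m=tq_k$ for some $k\ge0$ and some integer $t$ with $1\le t\le a_{k+1}$, or $m=\ell q_k+q_{k-1}$ for some $k\ge1$ and some integer $\ell$ with $1\le \ell<a_{k+1}$.
   Context: Continued fractions: $a_i$ are positive integers; $q_{-1}=0$, $q_0=1$, $q_1=a_1$, $q_k=a_kq_{k-1}+q_{k-2}$ for $k\ge2$. Sturmian words: identify the circle $\mathbb{T}$ with $[0,1)$, let $R(\rho)=\{\rho+\alpha\}$ ($\{\cdot\}$ = fractional part), and fix one of two conventions: $I_0=[0,1-\alpha)$, $I_1=[1-\alpha,1)$, or $I_0=(0,1-\alpha]$, $I_1=(1-\alpha,1]$. For $\rho\in\mathbb{T}$, the Sturmian word of slope $\alpha$ and intercept $\rho$ is the infinite binary word whose $n$-th letter ($n\ge0$) is $0$ if $R^n(\rho)\in I_0$ and $1$ otherwise; the Sturmian words of slope $\alpha$ are all such words for all $\rho$ and both conventions (they all have the same set of finite factors). Abelian periods: the Parikh vector of a binary word $u$ is $(|u|_0,|u|_1)$; a Parikh vector $P$ is contained in $Q$ if $P\le Q$ componentwise and $P\ne Q$. An abelian decomposition of a word $w$ is a factorization $w=u_0u_1\cdots u_{n-1}u_n$ with $n\ge2$ such that $u_1,\dots,u_{n-1}$ have a common Parikh vector $P$ and the Parikh vectors of $u_0$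 and $u_n$ are contained in $P$; the common length of $u_1,\dots,u_{n-1}$ is then an abelian period of $w$. The minimum abelian period of $w$ is the least abelian period of $w$. *)

theory Defs
  imports Complex_Main
begin

fun cf_rem :: "real \<Rightarrow> nat \<Rightarrow> real" where
  "cf_rem \<alpha> 0 = \<alpha>"
| "cf_rem \<alpha> (Suc k) = frac (1 / cf_rem \<alpha> k)"

fun cf_a :: "real \<Rightarrow> nat \<Rightarrow> nat" where
  "cf_a \<alpha> 0 = nat \<lfloor>\<alpha>\<rfloor>"
| "cf_a \<alpha> (Suc k) = nat \<lfloor>1 / cf_rem \<alpha> k\<rfloor>"

fun cf_q :: "real \<Rightarrow> nat \<Rightarrow> nat" where
  "cf_q \<alpha> 0 = 1"
| "cf_q \<alpha> (Suc 0) = cf_a \<alpha> 1"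
| "cf_q \<alpha> (Suc (Suc k)) = cf_a \<alpha> (k + 2) * cf_q \<alpha> (k + 1) + cf_q \<alpha> k"

definition rot :: "real \<Rightarrow> real \<Rightarrow> real" where
  "rot \<alpha> \<rho> = frac (\<rho> + \<alpha>)"

(* Sturmian word of slope alpha, intercept rho; conv = False:
   I_0 = [0,1-alpha); conv = True: I_0 = (0,1-alpha] (the point 0 of [0,1) is 1 \<in> I_1) *)
definition in_I0 :: "real \<Rightarrow> bool \<Rightarrow> real \<Rightarrow> bool" where
  "in_I0 \<alpha> conv x = (if conv then 0 < x \<and> x \<le> 1 - \<alpha> else 0 \<le> x \<and> x < 1 - \<alpha>)"

definition sturm :: "real \<Rightarrow> real \<Rightarrow> bool \<Rightarrow> nat \<Rightarrow> nat" where
  "sturm \<alpha> \<rho> conv n = (if in_I0 \<alpha> conv ((rot \<alpha> ^^ n) \<rho>) then 0 else 1)"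

definition sturmian_word :: "real \<Rightarrow> (nat \<Rightarrow> nat) \<Rightarrow> bool" where
  "sturmian_word \<alpha> s \<longleftrightarrow> (\<exists>\<rho> conv. 0 \<le> \<rho> \<and> \<rho> < 1 \<and> s = sturm \<alpha> \<rho> conv)"

definition factor_of :: "nat list \<Rightarrow> (nat \<Rightarrow> nat) \<Rightarrow> bool" where
  "factor_of w s \<longleftrightarrow> (\<exists>i. w = map s [i..<i + length w])"

definition parikh :: "nat list \<Rightarrow> nat \<times> nat" where
  "parikh u = (count_list u 0, count_list u 1)"

definition parikh_contained :: "nat \<times> nat \<Rightarrow> nat \<times> nat \<Rightarrow> bool" where
  "parikh_contained P Q \<longleftrightarrow> fst P \<le> fst Q \<and> snd P \<le> snd Q \<and> P \<noteq> Q"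

definition abelian_decomposition :: "nat list \<Rightarrow> nat list list \<Rightarrow> bool" where
  "abelian_decomposition w us \<longleftrightarrow>
     length us \<ge> 3 \<and> concat us = w \<and>
     (\<forall>i. 1 \<le> i \<and> i < length us - 1 \<longrightarrow> parikh (us ! i) = parikh (us ! 1)) \<and>
     parikh_contained (parikh (hd us)) (parikh (us ! 1)) \<and>
     parikh_contained (parikh (last us)) (parikh (us ! 1))"

definition abelian_period :: "nat list \<Rightarrow> nat \<Rightarrow> bool" where
  "abelian_period w p \<longleftrightarrow> (\<exists>us. abelian_decomposition w us \<and> length (us ! 1) = p)"

definition min_abelian_period :: "nat list \<Rightarrow> nat \<Rightarrow> bool" where
  "min_abelian_period w m \<longleftrightarrow> abelian_period w m \<and> (\<forall>p. abelian_period w p \<longrightarrow> m \<le> p)"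

end

theory Submission
  imports Defs
begin

text \<open>
  A Sturmian word codes a sequence \<open>h\<close> with \<open>h (i + 1) = h i + \<alpha> - s i\<close> and oscillation less than 1.
  For a length \<open>M\<close> with \<open>\<parallel>M\<alpha>\<parallel> < \<alpha>\<close>, a factor has abelian period \<open>M\<close> as soon as some residue class
  modulo \<open>M\<close> contains no starting position of an exceptional block, i.e. of a block across which \<open>h\<close>
  wraps around the circle.

  Suppose \<open>q\<^sub>k < m < q\<^bsub>k+1\<^esub>\<close> is an abelian period, with \<open>e\<close> full blocks, that is neither a multiple of
  \<open>q\<^sub>k\<close> nor a semiconvergent denominator. Then \<open>\<parallel>m\<alpha>\<parallel>\<close> exceeds \<open>\<parallel>q\<^sub>k\<alpha>\<parallel> + \<parallel>q\<^bsub>k-1\<^esub>\<alpha>\<parallel>\<close>, and since the \<open>e\<close> blocks drift by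
  less than 1 in total, \<open>e < q\<^sub>k\<close>. So the factor is short. Among any \<open>q\<^bsub>k+1\<^esub>\<close> consecutive positions at
  most \<open>t\<close> start an exceptional block of length \<open>t q\<^sub>k\<close>; counting these shows that a multiple
  \<open>t q\<^sub>k < m\<close> is an abelian period, except when \<open>e = q\<^sub>k - 1\<close> and \<open>m = l q\<^sub>k + 2 q\<^bsub>k-1\<^esub>\<close>. In that
  case the position of the factor on the circle is nearly determined, and \<open>l q\<^sub>k + q\<^bsub>k-1\<^esub>\<close> (for
  \<open>l \<ge> 1\<close>) or \<open>q\<^sub>k\<close> (for \<open>l = 0\<close>) is an abelian period.
\<close>

section \<open>Sturmian words as codings\<close>

text \<open>The orbit of the intercept, lifted to a half-open unit interval. Recording only the
  strict oscillation bound treats both conventions alike and survives shifts and a change of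
  sign.\<close>

definition coding :: "real \<Rightarrow> (nat \<Rightarrow> nat) \<Rightarrow> (nat \<Rightarrow> real) \<Rightarrow> bool" where
  "coding \<alpha> s h \<longleftrightarrow> (\<forall>i j. \<bar>h i - h j\<bar> < 1) \<and> (\<forall>i. s i \<in> {0, 1} \<and> h (Suc i) = h i + \<alpha> - real (s i))"

lemma frac_add_cases:
  assumes "0 \<le> x" "x < 1" "0 < a" "a < 1"
  shows "frac (x + a :: real) = (if x < 1 - a then x + a else x + a - 1)"
  using assms by (auto simp: frac_unique_iff)

lemma rot_iterate_bounds:
  assumes "0 \<le> \<rho>" "\<rho> < 1"
  shows "0 \<le> (rot \<alpha> ^^ n) \<rho>" "(rot \<alpha> ^^ n) \<rho> < 1"
  using assms by (cases n; simp add: rot_def frac_lt_1)+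

text \<open>For the convention \<open>I\<^sub>0 = (0, 1 - \<alpha>]\<close> the point 0 of the circle is represented by 1.\<close>

lemma sturmian_word_coding:
  assumes "0 < \<alpha>" "\<alpha> < 1" "sturmian_word \<alpha> s"
  obtains h where "coding \<alpha> s h"
proof -
  from assms(3) obtain \<rho> conv where r: "0 \<le> \<rho>" "\<rho> < 1" and s: "s = sturm \<alpha> \<rho> conv"
    by (auto simp: sturmian_word_def)
  define x where "x n = (rot \<alpha> ^^ n) \<rho>" for n
  have b: "0 \<le> x n" "x n < 1" for n
    using rot_iterate_bounds[OF r] by (auto simp: x_def)
  have st: "x (Suc n) = (if x n < 1 - \<alpha> then x n + \<alpha> else x n + \<alpha> - 1)" for n
    using frac_add_cases[OF b[of n] assms(1,2)] by (simp add: x_def rot_def)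
  have sn: "s n = (if in_I0 \<alpha> conv (x n) then 0 else 1)" for n
    by (simp add: s sturm_def x_def)
  show thesis
  proof (cases conv)
    case False
    have "coding \<alpha> s x"
      unfolding coding_def
    proof (intro conjI allI)
      show "\<bar>x i - x j\<bar> < 1" for i j using b[of i] b[of j] by linarith
      show "s i \<in> {0, 1}" for i by (simp add: sn)
      show "x (Suc i) = x i + \<alpha> - real (s i)" for i
        using b[of i] False by (auto simp: st sn in_I0_def)
    qed
    then show thesis by (rule that)
  next
    case True
    define h where "h n = (if x n = 0 then 1 else x n)" for n
    have hb: "0 < h n" "h n \<le> 1" for n
      using b[of n] by (auto simp: h_def)
    have "coding \<alpha> s h"
      unfolding coding_def
    proof (intro conjI allI)
      show "\<bar>h i - h j\<bar> < 1" for i j using hb[of i] hb[of j] by linarith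
      show "s i \<in> {0, 1}" for i by (simp add: sn)
      show "h (Suc i) = h i + \<alpha> - real (s i)" for i
        using b[of i] b[of "Suc i"] True assms(1,2)
        by (auto simp: st sn in_I0_def h_def split: if_splits)
    qed
    then show thesis by (rule that)
  qed
qed

lemma coding_shift: "coding \<alpha> s h \<Longrightarrow> coding \<alpha> (\<lambda>j. s (i + j)) (\<lambda>j. h (i + j))"
  by (auto simp: coding_def)

text \<open>The recursion telescopes. Blocks of equal length thus have equal Parikh vectors exactly
  when \<open>h\<close> changes by the same amount across them.\<close>

lemma count_list_coding:
  assumes "coding \<alpha> s h"
  shows "real (count_list (map s [b..<b + n]) 1) = real n * \<alpha> - (h (b + n) - h b)"
    and "count_list (map s [b..<b + n]) 0 + count_list (map s [b..<b + n]) 1 = n"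
proof (induction n)
  case 0
  {
    case 1 show ?case by simp
  next
    case 2 show ?case by simp
  }
next
  case (Suc n)
  have c: "s (b + n) = 0 \<or> s (b + n) = 1" "h (Suc (b + n)) = h (b + n) + \<alpha> - real (s (b + n))"
    using assms by (auto simp: coding_def)
  {
    case 1 show ?case using Suc.IH(1) c by (auto simp: algebra_simps)
  next
    case 2 show ?case using Suc.IH(2) c(1) by auto
  }
qed

lemma coding_diff:
  assumes "coding \<alpha> s h"
  obtains z :: int where "h (b + n) - h b = real n * \<alpha> - z"
  using count_list_coding(1)[OF assms, of b n] that[of "int (count_list (map s [b..<b + n]) 1)"]
  by simp

section \<open>Abelian decompositions in terms of the coding\<close>

lemma count_list_concat_const:
  "(\<And>u. u \<in> set us \<Longrightarrow> count_list u x = p) \<Longrightarrow> count_list (concat us) x = length us * p"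
  by (induction us) auto

lemma length_concat_const:
  "(\<And>u. u \<in> set us \<Longrightarrow> length u = p) \<Longrightarrow> length (concat us) = length us * p"
  by (induction us) auto

lemma count_list_binary_length:
  "set u \<subseteq> {0, 1::nat} \<Longrightarrow> length u = count_list u 0 + count_list u 1"
  by (induction u) auto

lemma abelian_periodE:
  assumes cod: "coding \<alpha> s h" and per: "abelian_period (map s [0..<L]) m"
  obtains c e r and p :: int where "c < m" "r < m" "1 \<le> e" "L = c + e * m + r"
    "h (c + e * m) - h c = real e * (real m * \<alpha> - p)"
proof -
  from per obtain us where d: "abelian_decomposition (map s [0..<L]) us" and m: "length (us ! 1) = m"
    by (auto simp: abelian_period_def)
  from d have l3: "length us \<ge> 3" by (simp add: abelian_decomposition_def)
  then obtain u0 vs where us0: "us = u0 # vs" by (cases us) auto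
  with l3 have "vs \<noteq> []" by auto
  then obtain mid ul where "vs = mid @ [ul]" by (metis append_butlast_last_id)
  with us0 have us: "us = u0 # mid @ [ul]" by simp
  have e1: "1 \<le> length mid" using l3 us by simp
  have us1: "us ! 1 = hd mid" using e1 by (cases mid) (auto simp: us)
  have conc: "map s [0..<L] = u0 @ concat mid @ ul"
    using d by (simp add: abelian_decomposition_def us)
  have bin: "set (map s [0..<L]) \<subseteq> {0, 1}" using cod unfolding coding_def by (metis imageE list.set_map subsetI)
  have bins: "set u0 \<subseteq> {0,1}" "set ul \<subseteq> {0,1}" "\<And>u. u \<in> set mid \<Longrightarrow> set u \<subseteq> {0,1}"
    using bin unfolding conc by auto
  have hdm: "hd mid \<in> set mid" using e1 by (cases mid) auto
  have pk: "parikh u = parikh (hd mid)" if "u \<in> set mid" for u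
  proof -
    obtain i where i: "i < length mid" "u = mid ! i" using \<open>u \<in> set mid\<close> by (auto simp: in_set_conv_nth)
    have "parikh (us ! Suc i) = parikh (us ! 1)"
      using d i(1) by (auto simp: abelian_decomposition_def us)
    then show ?thesis using i us1 by (simp add: us nth_append)
  qed
  have len: "length u = m" if "u \<in> set mid" for u
    using pk[OF that] count_list_binary_length[OF bins(3)[OF that]]
      count_list_binary_length[OF bins(3)[OF hdm]] m us1 by (simp add: parikh_def)
  \<comment> \<open>The two Parikh entries of a binary word add up to its length, so strict
    containment makes head and tail shorter than \<open>m\<close>.\<close>
  have lt: "length u < m" if "parikh_contained (parikh u) (parikh (hd mid))" "set u \<subseteq> {0,1}" for u
    using that count_list_binary_length[OF that(2)] count_list_binary_length[OF bins(3)[OF hdm]] m us1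
    by (auto simp: parikh_contained_def parikh_def)
  have cont: "parikh_contained (parikh u0) (parikh (hd mid))" "parikh_contained (parikh ul) (parikh (hd mid))"
    using d us1 by (auto simp: abelian_decomposition_def us)
  have lc: "length (concat mid) = length mid * m" by (rule length_concat_const) (rule len)
  have L: "L = length u0 + length mid * m + length ul"
    using arg_cong[OF conc, of length] lc by simp
  have "concat mid = take (length mid * m) (drop (length u0) (map s [0..<L]))"
    unfolding conc using lc by simp
  also have "\<dots> = map s [length u0..<length u0 + length mid * m]"
    by (simp add: L drop_map take_map)
  finally have cm: "concat mid = map s [length u0..<length u0 + length mid * m]" .
  have "count_list (concat mid) 1 = length mid * count_list (hd mid) 1"
    by (rule count_list_concat_const) (use pk in \<open>simp add: parikh_def\<close>)
  then have "h (length u0 + length mid * m) - h (length u0)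
      = real (length mid) * (real m * \<alpha> - int (count_list (hd mid) 1))"
    using count_list_coding(1)[OF cod, of "length u0" "length mid * m"] cm
    by (simp add: algebra_simps)
  with lt[OF cont(1) bins(1)] lt[OF cont(2) bins(2)] e1 L show thesis
    by (rule that)
qed

lemma concat_map_upt:
  "concat (map (\<lambda>j. map s [c + j * M..<c + j * M + M]) [0..<e]) = map s [c..<c + e * M]"
proof (induction e)
  case (Suc e)
  have "[c..<c + Suc e * M] = [c..<c + e * M] @ [c + e * M..<c + e * M + M]"
    using upt_add_eq_append[of c "c + e * M" M] by (simp add: ac_simps)
  then show ?case using Suc by simp
qed simp

text \<open>If \<open>\<parallel>M\<alpha>\<parallel> < \<alpha>\<close>, then every factor shorter than \<open>M\<close> has its Parikh vector contained in the
  frequent Parikh vector of length \<open>M\<close>, so head and tail impose no condition.\<close>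

lemma abelian_periodI:
  fixes p :: int
  assumes cod: "coding \<alpha> s h" and al: "0 < \<alpha>" "\<alpha> < 1/2" and M: "\<bar>real M * \<alpha> - p\<bar> < \<alpha>"
    and c: "c < M" and L: "c + M \<le> L"
    and blocks: "\<And>j. c + Suc j * M \<le> L \<Longrightarrow> h (c + j * M + M) - h (c + j * M) = real M * \<alpha> - p"
  shows "abelian_period (map s [0..<L]) M"
proof -
  define e where "e = (L - c) div M"
  have M0: "0 < M" using c by simp
  have "M \<le> L - c" using L by simp
  then have e1: "1 \<le> e" unfolding e_def using M0 by (simp add: div_greater_zero_iff Suc_leI)
  have "e * M + (L - c) mod M = L - c" unfolding e_def by simp
  then have eL: "c + e * M \<le> L" and rL: "L - (c + e * M) < M"
    using L mod_less_divisor[OF M0, of "L - c"] by linarith+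
  define bl where "bl j = map s [c + j * M..<c + j * M + M]" for j
  define us where "us = map s [0..<c] # map bl [0..<e] @ [map s [c + e * M..<L]]"
  have one: "real (count_list (bl j) 1) = p" if "j < e" for j
  proof -
    have "Suc j * M \<le> e * M" using that by (intro mult_right_mono) auto
    then have "c + Suc j * M \<le> L" using eL by linarith
    from blocks[OF this] show ?thesis
      using count_list_coding(1)[OF cod, of "c + j * M" M] by (simp add: bl_def)
  qed
  have sum: "count_list (bl j) 0 + count_list (bl j) 1 = M" for j
    using count_list_coding(2)[OF cod, of "c + j * M" M] by (simp add: bl_def)
  have pk: "parikh (bl j) = parikh (bl 0)" if "j < e" for j
    using one[OF that] one[of 0] e1 sum[of j] sum[of 0] by (simp add: parikh_def)
  have small: "parikh_contained (parikh (map s [b..<b + n])) (parikh (bl 0))" if n: "n < M" for b n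
  proof -
    let ?u = "map s [b..<b + n]"
    have n': "real n \<le> real M - 1" using n by linarith
    have hb: "\<bar>h (b + n) - h b\<bar> < 1" using cod by (auto simp: coding_def)
    \<comment> \<open>The worst case is \<open>n = M - 1\<close>: fewer than
      \<open>M * \<alpha> - \<alpha> + 1 < p + 1\<close> ones, and fewer than
      \<open>M - M * \<alpha> + \<alpha> < M - p + 2 * \<alpha>\<close> zeros, which is where
      \<alpha> < 1/2 enters.\<close>
    have a1: "real n * \<alpha> \<le> (real M - 1) * \<alpha>" using n' al by (intro mult_right_mono) auto
    have a0: "real n * (1 - \<alpha>) \<le> (real M - 1) * (1 - \<alpha>)" using n' al by (intro mult_right_mono) auto
    have u1: "real (count_list ?u 1) = real n * \<alpha> - (h (b + n) - h b)"
      by (rule count_list_coding(1)[OF cod])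
    have u0: "real (count_list ?u 0) = real n - real (count_list ?u 1)"
      using count_list_coding(2)[OF cod, of b n] by linarith
    have b1: "real (count_list (bl 0) 1) = p" using one e1 by simp
    have b0: "real (count_list (bl 0) 0) = real M - p" using sum[of 0] b1 by linarith
    have "real (count_list ?u 1) < real (count_list (bl 0) 1) + 1"
      using a1 u1 b1 hb M al by (simp add: algebra_simps abs_less_iff)
    moreover have "real (count_list ?u 0) < real (count_list (bl 0) 0) + 1"
      using a0 u0 u1 b0 hb M al by (simp add: algebra_simps abs_less_iff)
    ultimately have "count_list ?u 1 \<le> count_list (bl 0) 1" "count_list ?u 0 \<le> count_list (bl 0) 0"
      by linarith+
    moreover have "parikh ?u \<noteq> parikh (bl 0)"
      using count_list_coding(2)[OF cod, of b n] sum[of 0] n by (auto simp: parikh_def)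
    ultimately show ?thesis by (simp add: parikh_contained_def parikh_def)
  qed
  have us1: "us ! 1 = bl 0" using e1 by (simp add: us_def nth_append)
  have "abelian_decomposition (map s [0..<L]) us"
    unfolding abelian_decomposition_def
  proof (intro conjI allI impI)
    show "3 \<le> length us" using e1 by (simp add: us_def)
    have "[0..<c] @ [c..<c + e * M] @ [c + e * M..<L] = [0..<L]"
      using eL upt_add_eq_append[of 0 c "e * M"] upt_add_eq_append[of 0 "c + e * M" "L - (c + e * M)"] by simp
    moreover have "concat (map bl [0..<e]) = map s [c..<c + e * M]"
      unfolding bl_def by (rule concat_map_upt)
    ultimately show "concat us = map s [0..<L]"
      by (simp add: us_def flip: map_append)
    show "parikh (us ! i) = parikh (us ! 1)" if i: "1 \<le> i \<and> i < length us - 1" for i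
    proof -
      obtain i' where "i = Suc i'" using i by (cases i) auto
      moreover from this have "i' < e" using i by (simp add: us_def)
      ultimately show ?thesis using pk[of i'] us1 by (simp add: us_def nth_append)
    qed
    show "parikh_contained (parikh (hd us)) (parikh (us ! 1))"
      using small[OF c, of 0] us1 by (simp add: us_def)
    show "parikh_contained (parikh (last us)) (parikh (us ! 1))"
      using small[OF rL, of "c + e * M"] us1 eL by (simp add: us_def)
  qed
  moreover have "length (us ! 1) = M" unfolding us1 bl_def by simp
  ultimately show ?thesis by (auto simp: abelian_period_def)
qed

section \<open>Consecutive convergents\<close>

text \<open>Here \<open>q = q\<^sub>k\<close>, \<open>q' = q\<^bsub>k-1\<^esub>\<close>, \<open>a = a\<^bsub>k+1\<^esub>\<close>, \<open>D = \<parallel>q\<alpha>\<parallel>\<close>, \<open>D' = \<parallel>q'\<alpha>\<parallel>\<close>, and \<open>\<sigma>\<close> is the sign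
  of \<open>q\<alpha> - P\<close>.\<close>

locale convergents =
  fixes \<alpha> \<sigma> D D' :: real and q q' a :: nat and P P' :: int
  assumes alpha: "0 < \<alpha>" "\<alpha> < 1/2"
    and sign: "\<sigma> = 1 \<or> \<sigma> = -1"
    and approx: "\<sigma> * (real q * \<alpha> - P) = D" "\<sigma> * (real q' * \<alpha> - P') = - D'"
    and D: "0 < D" "D' \<le> \<alpha>" "real a * D < D'" "D' < (real a + 1) * D"
    and det: "real q * D' + real q' * D = 1"
    and q: "1 \<le> q'" "q' < q" "1 \<le> a"

section \<open>Convergents from the continued fraction algorithm\<close>

lemma floor_inverse_irrational:
  assumes "0 < x" "x < 1" "x \<notin> \<rat>"
  shows "1 \<le> nat \<lfloor>1 / x\<rfloor>" "real (nat \<lfloor>1 / x\<rfloor>) < 1 / x" "1 / x < real (nat \<lfloor>1 / x\<rfloor>) + 1"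
    "frac (1 / x) = 1 / x - real (nat \<lfloor>1 / x\<rfloor>)"
    "0 < frac (1 / x)" "frac (1 / x) < 1" "frac (1 / x) \<notin> \<rat>"
proof -
  have gt: "1 < 1 / x" using assms by simp
  then have fl: "1 \<le> \<lfloor>1 / x\<rfloor>" by linarith
  then show "1 \<le> nat \<lfloor>1 / x\<rfloor>" by linarith
  have r: "real (nat \<lfloor>1 / x\<rfloor>) = of_int \<lfloor>1 / x\<rfloor>" using fl of_nat_nat[of "\<lfloor>1 / x\<rfloor>"] by linarith
  then show fr: "frac (1 / x) = 1 / x - real (nat \<lfloor>1 / x\<rfloor>)" by (simp add: frac_def)
  have irr: "1 / x \<notin> \<rat>"
    using assms(3) Rats_divide[OF Rats_1, of "1 / x"] by auto
  then show irf: "frac (1 / x) \<notin> \<rat>"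
    unfolding fr using Rats_add[of "1 / x - real (nat \<lfloor>1 / x\<rfloor>)" "real (nat \<lfloor>1 / x\<rfloor>)"] by auto
  have "frac (1 / x) \<noteq> 0" using irf by (metis Rats_0)
  then show pos: "0 < frac (1 / x)" using frac_ge_0[of "1 / x"] by linarith
  then show "real (nat \<lfloor>1 / x\<rfloor>) < 1 / x" using fr by linarith
  show "frac (1 / x) < 1" by (rule frac_lt_1)
  then show "1 / x < real (nat \<lfloor>1 / x\<rfloor>) + 1" using fr by linarith
qed

lemma cf_rem_irrational:
  assumes "0 < \<alpha>" "\<alpha> < 1" "\<alpha> \<notin> \<rat>"
  shows "0 < cf_rem \<alpha> k \<and> cf_rem \<alpha> k < 1 \<and> cf_rem \<alpha> k \<notin> \<rat>"
proof (induction k)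
  case (Suc k)
  then show ?case using floor_inverse_irrational(5-7)[of "cf_rem \<alpha> k"] by simp
qed (use assms in simp)

text \<open>Induction along the recursion. The extra conjunct says that the ratio of consecutive
  errors is the current remainder; the floor of its inverse is the next partial quotient, whence the
  bounds on \<open>D'\<close> in terms of \<open>D\<close>.\<close>

lemma convergents_cf:
  assumes "0 < \<alpha>" "\<alpha> < 1/2" "\<alpha> \<notin> \<rat>"
  shows "\<exists>\<sigma> P P' D D'. cf_rem \<alpha> (Suc k) * D' = D \<and>
    convergents \<alpha> \<sigma> D D' (cf_q \<alpha> (Suc k)) (cf_q \<alpha> k) (cf_a \<alpha> (k + 2)) P P'"
proof -
  have rem: "0 < cf_rem \<alpha> k" "cf_rem \<alpha> k < 1" "cf_rem \<alpha> k \<notin> \<rat>" for k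
    using cf_rem_irrational[of \<alpha> k] assms by auto
  note inv = floor_inverse_irrational[OF rem]
  have bounds: "real (cf_a \<alpha> (Suc k)) * D < D'" "D' < (real (cf_a \<alpha> (Suc k)) + 1) * D"
    if "cf_rem \<alpha> k * D' = D" "0 < D" for k D D'
  proof -
    have "D' = 1 / cf_rem \<alpha> k * D" using that rem(1)[of k] by (auto simp: field_simps)
    then show "real (cf_a \<alpha> (Suc k)) * D < D'" "D' < (real (cf_a \<alpha> (Suc k)) + 1) * D"
      using inv(2,3)[of k] that(2) by (auto intro!: mult_strict_right_mono simp del: times_divide_eq_left)
  qed
  show ?thesis
  proof (induction k)
    case 0
    define b where "b = cf_a \<alpha> 1"
    define D where "D = 1 - real b * \<alpha>"
    have Dr: "cf_rem \<alpha> (Suc 0) * \<alpha> = D"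
      using inv(4)[of 0] assms(1) by (simp add: D_def b_def field_simps)
    have D0: "0 < D" using Dr rem(1)[of "Suc 0"] assms(1) by (metis mult_pos_pos)
    \<comment> \<open>A first partial quotient of 1 would make the first two denominators equal,
      against \<open>q' < q\<close>; \<alpha> < 1/2 prevents it.\<close>
    have "2 < 1 / \<alpha>" using assms by (simp add: field_simps)
    then have b2: "2 \<le> b" using inv(3)[of 0] by (simp add: b_def)
    have "convergents \<alpha> (-1) D \<alpha> b 1 (cf_a \<alpha> 2) 1 0"
      using assms D0 b2 bounds[OF Dr D0] inv(1)[of "Suc 0"]
      by unfold_locales (auto simp: D_def numeral_2_eq_2)
    then show ?case using Dr by (auto simp: b_def numeral_2_eq_2)
  next
    case (Suc k)
    then obtain \<sigma> P P' D D' where Dr: "cf_rem \<alpha> (Suc k) * D' = D"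
      and cv: "convergents \<alpha> \<sigma> D D' (cf_q \<alpha> (Suc k)) (cf_q \<alpha> k) (cf_a \<alpha> (k + 2)) P P'"
      by blast
    interpret convergents \<alpha> \<sigma> D D' "cf_q \<alpha> (Suc k)" "cf_q \<alpha> k" "cf_a \<alpha> (k + 2)" P P' by (rule cv)
    define a' where "a' = cf_a \<alpha> (k + 2)"
    \<comment> \<open>The error of the next denominator, made of \<open>a'\<close> steps of the
      current one and one of the previous one. The latter dominates since
      \<open>a' * D < D'\<close>, so the sign flips.\<close>
    define E where "E = D' - real a' * D"
    have Er: "cf_rem \<alpha> (Suc (Suc k)) * D = E"
    proof -
      define \<beta> where "\<beta> = cf_rem \<alpha> (Suc k)"
      have "cf_rem \<alpha> (Suc (Suc k)) = 1 / \<beta> - real a'"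
        using inv(4)[of "Suc k"] unfolding a'_def \<beta>_def
        by (simp only: cf_rem.simps cf_a.simps add_2_eq_Suc')
      moreover have "D = \<beta> * D'" "\<beta> > 0" using Dr rem(1)[of "Suc k"] by (simp_all add: \<beta>_def)
      moreover from this have "(1 / \<beta> - real a') * (\<beta> * D') = D' - real a' * (\<beta> * D')"
        by (simp add: field_simps)
      ultimately show ?thesis by (simp only: E_def)
    qed
    have E0: "0 < E" using Er rem(1)[of "Suc (Suc k)"] D(1) by (metis mult_pos_pos)
    have qn: "cf_q \<alpha> (Suc (Suc k)) = a' * cf_q \<alpha> (Suc k) + cf_q \<alpha> k" by (simp add: a'_def)
    have Da: "D \<le> \<alpha>"
    proof -
      have "1 * D \<le> real a' * D" using q(3) D(1) unfolding a'_def by (intro mult_right_mono) (simp_all del: cf_a.simps)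
      then show ?thesis using D(2,3) by (simp add: a'_def)
    qed
    have "cf_q \<alpha> (Suc k) \<le> a' * cf_q \<alpha> (Suc k)" using q(3) by (simp add: a'_def)
    then have q2: "cf_q \<alpha> (Suc k) < cf_q \<alpha> (Suc (Suc k))" unfolding qn using q(1) by linarith
    have P1: "- \<sigma> * (real (cf_q \<alpha> (Suc (Suc k))) * \<alpha> - (int a' * P + P')) = E"
    proof -
      have "- \<sigma> * (real (cf_q \<alpha> (Suc (Suc k))) * \<alpha> - (int a' * P + P'))
          = - (real a' * (\<sigma> * (real (cf_q \<alpha> (Suc k)) * \<alpha> - P)) + \<sigma> * (real (cf_q \<alpha> k) * \<alpha> - P'))"
        unfolding qn by (simp add: algebra_simps)
      then show ?thesis unfolding approx E_def by simp
    qed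
    have P2: "- \<sigma> * (real (cf_q \<alpha> (Suc k)) * \<alpha> - P) = - D"
      using approx by simp
    have dt: "real (cf_q \<alpha> (Suc (Suc k))) * D + real (cf_q \<alpha> (Suc k)) * E = 1"
      using det unfolding qn E_def by (simp add: algebra_simps)
    have "convergents \<alpha> (-\<sigma>) E D (cf_q \<alpha> (Suc (Suc k))) (cf_q \<alpha> (Suc k)) (cf_a \<alpha> (Suc k + 2)) (int a' * P + P') P"
      by unfold_locales
        (use assms sign P1 P2 E0 Da bounds[OF Er E0] dt q2 q inv(1)[of "Suc (Suc k)"] in \<open>auto simp del: cf_q.simps\<close>)
    then show ?case using Er by blast
  qed
qed

section \<open>Shorter abelian periods\<close>

text \<open>Pigeonhole: cut the line above the least value into cells of width \<open>D\<close>.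
  Separated values lie in different cells, and only the first \<open>t\<close> cells can be
  occupied.\<close>

lemma card_separated_le:
  fixes f :: "'a \<Rightarrow> real"
  assumes "finite S" "0 < D"
    and sep: "\<And>i j. i \<in> S \<Longrightarrow> j \<in> S \<Longrightarrow> i \<noteq> j \<Longrightarrow> D \<le> \<bar>f i - f j\<bar>"
    and close: "\<And>i j. i \<in> S \<Longrightarrow> j \<in> S \<Longrightarrow> \<bar>f i - f j\<bar> < real t * D"
  shows "card S \<le> t"
proof (cases "S = {}")
  case False
  define m where "m = Min (f ` S)"
  have "m \<in> f ` S" unfolding m_def using assms(1) False by simp
  then obtain i0 where i0: "i0 \<in> S" "m = f i0" by auto
  have m: "m \<le> f i" if "i \<in> S" for i unfolding m_def using assms(1) that by simp
  define \<phi> where "\<phi> i = nat \<lfloor>(f i - m) / D\<rfloor>" for i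
  have "inj_on \<phi> S"
  proof (rule inj_onI, rule ccontr)
    fix i j assume ij: "i \<in> S" "j \<in> S" "\<phi> i = \<phi> j" "i \<noteq> j"
    have "0 \<le> (f i - m) / D" "0 \<le> (f j - m) / D" using m ij assms(2) by auto
    then have "\<lfloor>(f i - m) / D\<rfloor> = \<lfloor>(f j - m) / D\<rfloor>" using ij(3) unfolding \<phi>_def
      by (metis eq_nat_nat_iff zero_le_floor)
    then have "\<bar>(f i - m) / D - (f j - m) / D\<bar> < 1" by linarith
    then have "\<bar>f i - f j\<bar> < D" using assms(2) by (simp flip: diff_divide_distrib)
    then show False using sep[OF ij(1,2,4)] by linarith
  qed
  moreover have "\<phi> ` S \<subseteq> {..<t}"
  proof
    fix y assume "y \<in> \<phi> ` S"
    then obtain i where i: "i \<in> S" "y = \<phi> i" by auto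
    have "f i - m < real t * D" using close[OF i(1) i0(1)] i0(2) by simp
    then have "(f i - m) / D < real t" using assms(2) by (simp add: divide_less_eq)
    moreover have "0 \<le> (f i - m) / D" using m[OF i(1)] assms(2) by simp
    ultimately show "y \<in> {..<t}" unfolding i(2) \<phi>_def by (simp, linarith)
  qed
  ultimately show ?thesis by (metis card_inj_on_le card_lessThan finite_lessThan)
qed simp

lemma card_le_windows:
  fixes H :: "nat set"
  assumes "H \<subseteq> {c..<c + n * w}" and win: "\<And>u. card (H \<inter> {u..<u + w}) \<le> t"
  shows "card H \<le> n * t"
  using assms
proof (induction n arbitrary: H)
  case (Suc n)
  let ?A = "H \<inter> {c..<c + n * w}" and ?B = "H \<inter> {c + n * w..<c + n * w + w}"
  have "H = ?A \<union> ?B" using Suc.prems(1) by (auto simp: algebra_simps)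
  then have "card H \<le> card ?A + card ?B" by (metis card_Un_le)
  also have "card ?A \<le> n * t"
  proof (rule Suc.IH)
    show "card (?A \<inter> {u..<u + w}) \<le> t" for u
    proof -
      have "card (?A \<inter> {u..<u + w}) \<le> card (H \<inter> {u..<u + w})" by (intro card_mono) auto
      then show ?thesis using Suc.prems(2)[of u] by linarith
    qed
  qed simp
  also have "card ?B \<le> t" by (rule Suc.prems(2))
  finally show ?case by simp
qed simp

section \<open>Best approximation along a coding\<close>

locale coded_convergents = convergents +
  fixes s :: "nat \<Rightarrow> nat" and h :: "nat \<Rightarrow> real"
  assumes cod: "coding \<alpha> s h"
begin

text \<open>The factor \<sigma> merges the two signs of the error: modulo 1, a step of length
  \<open>q\<close> raises \<open>g\<close> by \<open>D\<close> and one of length \<open>q'\<close>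
  lowers it by \<open>D'\<close>.\<close>

definition g :: "nat \<Rightarrow> real" where
  "g i = \<sigma> * h i"

lemma g_close: "\<bar>g i - g j\<bar> < 1"
proof -
  have "\<bar>h i - h j\<bar> < 1" using cod by (simp add: coding_def)
  then show ?thesis using sign by (auto simp: g_def)
qed

lemma g_shift:
  fixes p :: int
  assumes "\<sigma> * (real n * \<alpha> - p) = \<epsilon>"
  obtains z :: int where "g (i + n) = g i + \<epsilon> + z" "\<bar>\<epsilon> + z\<bar> < 1"
proof -
  obtain z :: int where z: "h (i + n) - h i = real n * \<alpha> - z" by (rule coding_diff[OF cod])
  obtain \<tau> :: int where \<tau>: "\<sigma> = \<tau>" using sign by (metis of_int_1 of_int_minus)
  have "g (i + n) - g i = \<sigma> * (h (i + n) - h i)" by (simp add: g_def algebra_simps)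
  also have "\<dots> = \<epsilon> + of_int (\<tau> * (p - z))" unfolding z using assms \<tau> by (auto simp: algebra_simps)
  finally have e: "g (i + n) = g i + \<epsilon> + of_int (\<tau> * (p - z))" by simp
  moreover have "\<bar>\<epsilon> + of_int (\<tau> * (p - z))\<bar> < 1" using g_close[of "i + n" i] e by linarith
  ultimately show thesis by (rule that)
qed

lemma signed_error:
  assumes "int n = x * int q + y * int q'"
  shows "\<sigma> * (real n * \<alpha> - (x * P + y * P')) = x * D - y * D'"
proof -
  have "real n = x * real q + y * real q'" using arg_cong[OF assms, of real_of_int] by simp
  then have "\<sigma> * (real n * \<alpha> - (x * P + y * P'))
      = x * (\<sigma> * (real q * \<alpha> - P)) + y * (\<sigma> * (real q' * \<alpha> - P'))"
    by (simp add: algebra_simps)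
  then show ?thesis unfolding approx by simp
qed

text \<open>By \<open>det\<close>, the pairs \<open>(q, P)\<close> and \<open>(q', P')\<close> have
  determinant 1 or -1, so they form a basis of the integer plane. \<open>signed_error\<close> then
  reads errors off the coordinates.\<close>

lemma unimodular:
  fixes n p :: int
  obtains x y where "n = x * int q + y * int q'" "p = x * P + y * P'"
proof -
  have "real q' * (\<sigma> * (real q * \<alpha> - P)) - real q * (\<sigma> * (real q' * \<alpha> - P')) = 1"
    unfolding approx using det by simp
  then have "\<sigma> * real_of_int (int q * P' - int q' * P) = 1" by (simp add: algebra_simps)
  then have "real_of_int (int q * P' - int q' * P) = 1 \<or> real_of_int (int q * P' - int q' * P) = -1"
    using sign by auto
  then have "int q * P' - int q' * P = 1 \<or> int q * P' - int q' * P = -1"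
    by (metis of_int_1 of_int_eq_iff of_int_minus)
  then obtain \<tau> where \<tau>: "\<tau> * (int q * P' - int q' * P) = 1" by (metis mult_1 mult_minus1 minus_minus)
  show thesis
  proof (rule that)
    have "n = n * (\<tau> * (int q * P' - int q' * P))" "p = p * (\<tau> * (int q * P' - int q' * P))"
      unfolding \<tau> by simp_all
    then show "n = (\<tau> * (n * P' - p * int q')) * int q + (\<tau> * (int q * p - n * P)) * int q'"
      "p = (\<tau> * (n * P' - p * int q')) * P + (\<tau> * (int q * p - n * P)) * P'"
      by (simp_all add: algebra_simps)
  qed
qed

lemma D'_pos: "0 < D'"
  using D by (smt (verit) mult_nonneg_nonneg of_nat_0_le_iff)

text \<open>Best approximation, \<open>a * q + q'\<close> being the next denominator. For the
  coordinates of a shorter length, \<open>y = 0\<close> and \<open>y \<le> -1\<close> each force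
  \<open>x \<ge> 1\<close>, and \<open>y \<ge> 1\<close> forces \<open>x < a\<close>; each time
  \<open>x * D - y * D'\<close> has size at least \<open>D\<close>.\<close>

lemma gap:
  assumes "i < j" "\<bar>g i - g j\<bar> < D"
  shows "i + (a * q + q') \<le> j"
proof (rule ccontr)
  assume neg: "\<not> ?thesis"
  define n where "n = j - i"
  have n: "0 < n" "n < a * q + q'" "j = i + n" using assms(1) neg by (auto simp: n_def)
  obtain z :: int where z: "g j = g i + \<sigma> * (real n * \<alpha> - 0) + z"
    using g_shift[of n 0 _ i] n(3) by auto
  \<comment> \<open>As \<sigma> is its own inverse, pairing \<open>n\<close> with the integer
    \<open>- (\<tau> * z)\<close> makes the signed error the exact change of
    \<open>g\<close>.\<close>
  obtain \<tau> :: int where \<tau>: "\<sigma> = \<tau>" "\<tau> * \<tau> = 1" using sign by (metis of_int_1 of_int_minus mult_1 mult_minus1 minus_minus)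
  obtain x y where xy: "int n = x * int q + y * int q'" "- (\<tau> * z) = x * P + y * P'"
    by (rule unimodular)
  have "\<sigma> * (real n * \<alpha> - (- (\<tau> * z))) = x * D - y * D'"
    using signed_error[OF xy(1)] unfolding xy(2)[symmetric] by simp
  moreover have "\<sigma> * of_int \<tau> = 1" unfolding \<tau>(1) using \<tau>(2) by (metis of_int_1 of_int_mult)
  then have "\<sigma> * (of_int \<tau> * of_int z) = of_int z" by (simp flip: mult.assoc)
  ultimately have e: "g j - g i = x * D - y * D'" unfolding z by (simp add: algebra_simps)
  have small: "\<bar>x * D - y * D'\<bar> < D" using assms(2) unfolding e[symmetric] by linarith
  have qs: "int q > 0" "int q' > 0" using q by auto
  consider "y = 0" | "1 \<le> y" | "y \<le> -1" by linarith
  then show False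
  proof cases
    case 1
    then have "x * int q > 0" using xy(1) n(1) by simp
    then have "1 \<le> x" using qs by (simp add: zero_less_mult_iff)
    then have "1 * D \<le> x * D" using D(1) by (intro mult_right_mono) auto
    then show False using small 1 by simp
  next
    case 2
    then have "1 * int q' \<le> y * int q'" using qs by (intro mult_right_mono) auto
    moreover have "int n < int a * int q + int q'" using n(2) by (metis of_nat_add of_nat_less_iff of_nat_mult)
    ultimately have "x * int q < int a * int q" using xy(1) by linarith
    then have "x \<le> int a - 1" using qs by (simp add: mult_less_cancel_right)
    then have "x * D \<le> (real a - 1) * D" using D(1) by (intro mult_right_mono) linarith+
    moreover have "1 * D' \<le> y * D'" using 2 D'_pos by (intro mult_right_mono) auto
    ultimately show False using small D(3) by (simp add: algebra_simps)
  next
    case 3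
    then have "y * int q' \<le> (-1) * int q'" using qs by (intro mult_right_mono) auto
    then have "x * int q > 0" using xy(1) n(1) qs by linarith
    then have "1 \<le> x" using qs by (simp add: zero_less_mult_iff)
    then have "1 * D \<le> x * D" using D(1) by (intro mult_right_mono) auto
    moreover have "y * D' \<le> (-1) * D'" using 3 D'_pos by (intro mult_right_mono) auto
    ultimately show False using small D'_pos by linarith
  qed
qed

section \<open>Exceptional blocks and multiples of a denominator\<close>

definition hit :: "nat \<Rightarrow> nat \<Rightarrow> bool" where
  "hit t i \<longleftrightarrow> g (i + t * q) \<noteq> g i + real t * D"

context
  fixes t :: nat
  assumes t: "1 \<le> t" "t \<le> a"
begin

lemma multiple_bounds: "0 < real t * D" "real t * D < D'" "real t * D < \<alpha>"
proof -
  show "0 < real t * D" using t(1) D(1) by simp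
  have "real t * D \<le> real a * D" using t(2) D(1) by (intro mult_right_mono) auto
  then show "real t * D < D'" "real t * D < \<alpha>" using D by linarith+
qed

lemma multiple_error: "\<sigma> * (real (t * q) * \<alpha> - (int t * P)) = real t * D"
  using signed_error[of "t * q" "int t" 0] by simp

text \<open>The change of \<open>g\<close> is known modulo 1, and \<open>0 < t * D < 1\<close> with
  the oscillation bound leaves only the corrections 0 and -1. A hit is thus a single wrap around the
  circle.\<close>

lemma hit_eq:
  assumes "hit t i"
  shows "g (i + t * q) = g i + real t * D - 1"
proof -
  obtain z :: int where z: "g (i + t * q) = g i + real t * D + z" "\<bar>real t * D + z\<bar> < 1"
    by (rule g_shift[OF multiple_error])
  have "z \<noteq> 0" using assms z(1) by (auto simp: hit_def)
  moreover have "- 2 < z" "z < 1" using z(2) multiple_bounds alpha by linarith+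
  ultimately have "z = -1" by linarith
  then show ?thesis using z(1) by simp
qed

text \<open>A hit at \<open>j\<close> brings \<open>g\<close> down to
  \<open>g j + t * D - 1\<close>, so no value of \<open>g\<close> reaches
  \<open>g j + t * D\<close>.\<close>

lemma hits_close: "hit t i \<Longrightarrow> hit t j \<Longrightarrow> \<bar>g i - g j\<bar> < real t * D"
  using hit_eq[of i] hit_eq[of j] g_close[of i "j + t * q"] g_close[of j "i + t * q"] by linarith

lemma card_hits_window:
  assumes "\<And>i. i \<in> H \<Longrightarrow> hit t i"
  shows "card (H \<inter> {u..<u + (a * q + q')}) \<le> t"
proof (rule card_separated_le[where f = g and D = D])
  fix i j assume ij: "i \<in> H \<inter> {u..<u + (a * q + q')}" "j \<in> H \<inter> {u..<u + (a * q + q')}"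
  show "\<bar>g i - g j\<bar> < real t * D" using ij assms by (intro hits_close) auto
  assume "i \<noteq> j"
  then consider "i < j" | "j < i" by linarith
  then show "D \<le> \<bar>g i - g j\<bar>"
    using gap[of i j] gap[of j i] ij by cases (force simp: abs_minus_commute)+
qed (use D in auto)

text \<open>Neighbouring values of \<open>g\<close> differ by \<alpha> or 1 - \<alpha>, both at
  least \<alpha>, while hits are less than \<open>t * D < \<alpha>\<close> apart. This serves
  factors with room for only one block.\<close>

lemma not_both_hit: "\<not> (hit t 0 \<and> hit t 1)"
proof
  assume "hit t 0 \<and> hit t 1"
  then have "\<bar>g 1 - g 0\<bar> < \<alpha>" using hits_close[of 1 0] multiple_bounds by auto
  moreover have "h 1 - h 0 = \<alpha> \<or> h 1 - h 0 = \<alpha> - 1" using cod by (auto simp: coding_def)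
  then have "\<bar>h 1 - h 0\<bar> \<ge> \<alpha>" using alpha by auto
  then have "\<bar>g 1 - g 0\<bar> \<ge> \<alpha>" using sign by (auto simp: g_def abs_minus_commute)
  ultimately show False by simp
qed

text \<open>The starts from \<open>lo\<close> on fit into \<open>q - 1\<close> windows with at most
  \<open>t\<close> hits each, so there are fewer than \<open>t * q\<close> hits and some residue
  class avoids them all. The parameter \<open>lo\<close> accounts for an initial stretch known to be
  free of hits.\<close>

lemma abelian_period_multiple:
  assumes none: "\<And>i. i < lo \<Longrightarrow> \<not> hit t i"
    and L: "t * q + 1 \<le> L" "L < t * q + lo + (q - 1) * (a * q + q')"
  shows "abelian_period (map s [0..<L]) (t * q)"
proof -
  define M where "M = t * q"
  define H where "H = {i. i + M \<le> L \<and> hit t i}"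
  have "1 * 2 \<le> t * q" using t q by (intro mult_mono) auto
  then have M2: "2 \<le> M" by (simp add: M_def)
  have fin: "finite H" by (rule finite_subset[of _ "{..L}"]) (auto simp: H_def)
  have "card H \<le> (q - 1) * t"
  proof (rule card_le_windows)
    show "H \<subseteq> {lo..<lo + (q - 1) * (a * q + q')}"
    proof
      fix i assume i: "i \<in> H"
      then have "lo \<le> i" using none by (auto simp: H_def not_less[symmetric])
      moreover have "i + M \<le> L" using i by (simp add: H_def)
      ultimately show "i \<in> {lo..<lo + (q - 1) * (a * q + q')}" using L(2) by (simp add: M_def)
    qed
    show "card (H \<inter> {u..<u + (a * q + q')}) \<le> t" for u
      by (rule card_hits_window) (simp add: H_def)
  qed
  also have "(q - 1) * t < q * t" using t q by (intro mult_strict_right_mono) auto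
  finally have cH: "card H < M" by (simp add: M_def mult.commute)
  have "\<exists>c < M. c + M \<le> L \<and> (\<forall>j. c + Suc j * M \<le> L \<longrightarrow> \<not> hit t (c + j * M))"
  proof (cases "2 * M \<le> L + 1")
    case True
    have "card ((\<lambda>i. i mod M) ` H) < card {..<M}" using card_image_le[OF fin, of "\<lambda>i. i mod M"] cH by simp
    then obtain c where c: "c < M" "c \<notin> (\<lambda>i. i mod M) ` H"
      by (metis card_mono fin finite_imageI lessThan_iff not_le subsetI)
    have "\<not> hit t (c + j * M)" if "c + Suc j * M \<le> L" for j
    proof
      assume "hit t (c + j * M)"
      then have "c + j * M \<in> H" using that by (simp add: H_def)
      then have "(c + j * M) mod M \<in> (\<lambda>i. i mod M) ` H" by blast
      then show False using c by simp
    qed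
    then show ?thesis using c(1) True by (intro exI[of _ c]) auto
  next
    \<comment> \<open>At most one block fits, and a free residue might come too late even for that
      one. The starts 0 and 1 have room since \<open>t * q + 1 \<le> L\<close>.\<close>
    case False
    obtain c :: nat where c: "c \<le> 1" "\<not> hit t c" using not_both_hit by (metis le_refl zero_le_one)
    have "j = 0" if "c + Suc j * M \<le> L" for j
    proof (rule ccontr)
      assume "j \<noteq> 0"
      then have "2 * M \<le> Suc j * M" by (intro mult_right_mono) auto
      then show False using that False by linarith
    qed
    then have "\<not> hit t (c + j * M)" if "c + Suc j * M \<le> L" for j using c(2) that by fastforce
    then show ?thesis using c(1) L M2 by (intro exI[of _ c]) (auto simp: M_def)
  qed
  then obtain c where c: "c < M" "c + M \<le> L" "\<And>j. c + Suc j * M \<le> L \<Longrightarrow> \<not> hit t (c + j * M)"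
    by blast
  have sq: "\<sigma> * \<sigma> = 1" using sign by auto
  have er: "real M * \<alpha> - (int t * P) = \<sigma> * (real t * D)"
    using arg_cong[OF multiple_error, of "\<lambda>v. \<sigma> * v"] sq by (simp add: M_def mult.assoc[symmetric])
  have "abelian_period (map s [0..<L]) M"
  proof (rule abelian_periodI[OF cod alpha _ c(1,2)])
    show "\<bar>real M * \<alpha> - of_int (int t * P)\<bar> < \<alpha>"
      using er sign multiple_bounds by auto
    show "h (c + j * M + M) - h (c + j * M) = real M * \<alpha> - of_int (int t * P)" if "c + Suc j * M \<le> L" for j
    proof -
      have "\<sigma> * (h (c + j * M + M) - h (c + j * M)) = real t * D"
        using c(3)[OF that] by (simp add: hit_def g_def M_def algebra_simps)
      then show ?thesis unfolding er using sign by auto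
    qed
  qed
  then show ?thesis by (simp add: M_def)
qed

end

text \<open>With \<open>M = l * q + q'\<close> and \<open>\<eta> = D' - l * D\<close>, a block of
  length \<open>m\<close> lowers \<open>g\<close> by \<open>2 * \<eta> + l * D\<close>. So the
  \<open>e\<close> given blocks descend further than \<open>2 * e\<close> blocks of length
  \<open>M\<close>, with at least \<open>D\<close> to spare. At most \<open>2 * e\<close> of the
  latter fit, and none of them wraps.\<close>

lemma abelian_period_semiconvergent:
  assumes l: "1 \<le> l" "l < a" and m: "m = l * q + 2 * q'"
    and c: "c < m" and r: "r < m" and e: "2 \<le> e" and L: "L = c + e * m + r"
    and drift: "g (c + e * m) = g c - real e * (2 * D' - real l * D)"
  shows "abelian_period (map s [0..<L]) (l * q + q')"
proof -
  define M where "M = l * q + q'"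
  define \<eta> where "\<eta> = D' - real l * D"
  have mM: "m = M + q'" by (simp add: m M_def)
  have qM: "q \<le> M" using l by (simp add: M_def trans_le_add1)
  have lD: "real l * D \<le> (real a - 1) * D" using l(2) D(1) by (intro mult_right_mono) auto
  have "1 * D \<le> real l * D" using l D by (intro mult_right_mono) auto
  then have eta: "0 < \<eta>" "\<eta> < \<alpha>" unfolding \<eta>_def using lD D left_diff_distrib[of "real a" 1 D] by linarith+
  have elD: "D \<le> real e * (real l * D)"
  proof -
    have "1 * D \<le> (real e * real l) * D" using e l D(1)
      by (intro mult_right_mono) (auto simp flip: of_nat_mult simp: Suc_le_eq)
    then show ?thesis by (simp add: mult.assoc)
  qed
  have de: "real e * (2 * D' - real l * D) = 2 * real e * \<eta> + real e * (real l * D)"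
    by (simp add: \<eta>_def algebra_simps)
  have err: "\<sigma> * (real M * \<alpha> - (int l * P + 1 * P')) = - \<eta>"
    using signed_error[of M "int l" 1] by (simp add: M_def \<eta>_def)
  \<comment> \<open>A start must lie below \<open>M\<close>. If \<open>c\<close> does not, then
    \<open>c - q\<close> does, as \<open>c < M + q'\<close>; the spare \<open>D\<close> pays for the
    lower value of \<open>g\<close> there.\<close>
  obtain c' where c': "c' < M" "c' \<le> c" "c \<le> c' + q" "g c - D \<le> g c'" "g c' \<le> g c"
  proof (cases "c < M")
    case True
    then show thesis using that[of c] D by simp
  next
    case False
    have qc: "c - q + q = c" using qM False by simp
    have "\<sigma> * (real q * \<alpha> - P) = D" by (rule approx)
    then obtain z :: int where z: "g (c - q + q) = g (c - q) + D + z" "\<bar>D + z\<bar> < 1" by (rule g_shift)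
    have "real_of_int (- z) < 1 + D - real e * (2 * D' - real l * D)"
      using g_close[of "c - q" "c + e * m"] drift z(1) unfolding qc by auto
    also have "\<dots> \<le> 1"
    proof -
      have "0 \<le> 2 * real e * \<eta>" using eta by simp
      then show ?thesis using elD unfolding de by linarith
    qed
    finally have "z \<ge> 0" by simp
    moreover have "real_of_int z < 1" using z(2) D(1) by linarith
    then have "z \<le> 0" by simp
    ultimately have "z = 0" by simp
    then show thesis using that[of "c - q"] z(1) qc False c mM q D(1) by auto
  qed
  have cM: "c' + M \<le> L"
  proof -
    have "1 * m \<le> e * m" using e by (intro mult_right_mono) auto
    then show ?thesis using c' L mM by linarith
  qed
  have few: "Suc j \<le> 2 * e" if "c' + Suc j * M \<le> L" for j
  proof (rule ccontr)
    assume "\<not> ?thesis"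
    then have "(2 * e + 1) * M \<le> Suc j * M" by (intro mult_right_mono) auto
    then have 1: "(2 * e + 1) * M < q + (e * m + m)" using that c' L r by linarith
    have "q + (e * m + m) = q + q' + e * q' + (e + 1) * M" by (simp add: mM algebra_simps)
    also have "q + q' \<le> 2 * q" using q by simp
    also have "2 * q \<le> e * (l * q)" using e l by (simp add: mult_le_mono)
    also have "e * (l * q) + e * q' + (e + 1) * M = (2 * e + 1) * M" by (simp add: M_def algebra_simps)
    finally show False using 1 by simp
  qed
  have run: "g (c' + j * M) = g c' - real j * \<eta>" if "j * M \<le> L - c'" for j
    using that
  proof (induction j)
    case (Suc j)
    then have IH: "g (c' + j * M) = g c' - real j * \<eta>" by simp
    obtain z :: int where z: "g (c' + j * M + M) = g (c' + j * M) + - \<eta> + z" "\<bar>- \<eta> + z\<bar> < 1"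
      by (rule g_shift[OF err])
    have "Suc j \<le> 2 * e" using few[of j] Suc.prems cM by simp
    then have "real (Suc j) * \<eta> \<le> (2 * real e) * \<eta>" using eta by (intro mult_right_mono) linarith+
    \<comment> \<open>A wrap would put this value at least 1 above
      \<open>g (c + e * m)\<close>.\<close>
    then have "real_of_int z < 1"
      using g_close[of "c' + j * M + M" "c + e * m"] drift z(1) IH c'(4) elD unfolding de
      by (auto simp: algebra_simps)
    moreover have "- 1 < real_of_int z" using z(2) eta by linarith
    ultimately have "z = 0" by simp
    then show ?case using z(1) IH by (simp add: algebra_simps)
  qed simp
  have er: "real M * \<alpha> - of_int (int l * P + 1 * P') = - \<sigma> * \<eta>"
    using err sign by auto
  have "abelian_period (map s [0..<L]) M"
  proof (rule abelian_periodI[OF cod alpha _ c'(1) cM])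
    show "\<bar>real M * \<alpha> - of_int (int l * P + 1 * P')\<bar> < \<alpha>"
      unfolding er using sign eta by auto
    show "h (c' + j * M + M) - h (c' + j * M) = real M * \<alpha> - of_int (int l * P + 1 * P')"
      if "c' + Suc j * M \<le> L" for j
    proof -
      have "g (c' + j * M + M) - g (c' + j * M) = - \<eta>"
      proof -
        have "j * M \<le> L - c'" "Suc j * M \<le> L - c'" using that by simp_all
        from run[OF this(1)] run[OF this(2)] show ?thesis by (simp add: algebra_simps)
      qed
      then show ?thesis unfolding er using sign by (auto simp: g_def)
    qed
  qed
  then show ?thesis by (simp add: M_def)
qed

text \<open>For the coordinates of \<open>m\<close>, \<open>y = 0\<close> gives a multiple of
  \<open>q\<close> and \<open>y = 1\<close> a semiconvergent, both excluded. Any other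
  \<open>y\<close> has a large error \<open>E\<close>, while the \<open>e\<close> blocks drift by
  \<open>e * E < 1\<close>. So the factor is short, and in the longest case only
  \<open>y = 2\<close> and \<open>y = -1\<close> remain.\<close>

lemma shorter_abelian_period:
  assumes m: "q < m" "m < a * q + q'"
    and nm: "\<And>t. 1 \<le> t \<Longrightarrow> t \<le> a \<Longrightarrow> m \<noteq> t * q"
    and ns: "\<And>l. 1 \<le> l \<Longrightarrow> l < a \<Longrightarrow> m \<noteq> l * q + q'"
    and per: "abelian_period (map s [0..<L]) m"
  shows "\<exists>M < m. abelian_period (map s [0..<L]) M"
proof -
  obtain c e r and p :: int where c: "c < m" and r: "r < m" and e1: "1 \<le> e" and L: "L = c + e * m + r"
    and hd: "h (c + e * m) - h c = real e * (real m * \<alpha> - p)"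
    by (rule abelian_periodE[OF cod per])
  have "1 * m \<le> e * m" using e1 by (intro mult_right_mono) auto
  then have mL: "m \<le> L" using L by linarith
  define t where "t = m div q"
  have mt: "m = t * q + m mod q" by (simp add: t_def)
  have rq: "m mod q < q" using q by simp
  have t1: "1 \<le> t" unfolding t_def using m q by (simp add: Suc_le_eq div_greater_zero_iff)
  have "t * q < (a + 1) * q" using m q mt by (simp add: algebra_simps)
  then have ta: "t \<le> a" unfolding mult_less_cancel2 by simp
  have tm: "t * q < m" using nm[OF t1 ta] mt by linarith
  show ?thesis
  proof (cases "e + 2 \<le> q")
    case True
    \<comment> \<open>Of \<open>q\<close> copies of \<open>m\<close>, enlarge \<open>q - 1\<close>
      to \<open>m + 1 \<le> a * q + q'\<close>. The gain of \<open>q - 1\<close> absorbs the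
      remainder of the last copy modulo \<open>q\<close>.\<close>
    have "(e + 2) * m \<le> q * m" using True by (intro mult_right_mono) auto
    moreover have "q * m = (q - 1) * m + m" using q by (cases q) auto
    moreover have "(q - 1) * (m + 1) \<le> (q - 1) * (a * q + q')" using m by (intro mult_left_mono) auto
    moreover have "L < (e + 2) * m" "L + 2 \<le> (e + 2) * m" using L c r by simp_all
    ultimately have "L < t * q + 0 + (q - 1) * (a * q + q')"
      using mt rq by (simp add: algebra_simps)
    then have "abelian_period (map s [0..<L]) (t * q)"
      using tm mL by (intro abelian_period_multiple[OF t1 ta, where lo = 0]) auto
    then show ?thesis using tm by blast
  next
    case False
    \<comment> \<open>Otherwise \<open>q = 2\<close> and \<open>q' = 1\<close>, so \<open>m\<close>
      is odd and of the excluded form \<open>t * q + q'\<close>.\<close>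
    have e2: "2 \<le> e"
    proof (rule ccontr)
      assume "\<not> 2 \<le> e"
      then have q2: "q = 2" "q' = 1" using e1 False q by auto
      then have "m mod q = 1" using tm mt rq by linarith
      then have mq: "m = t * q + q'" using mt q2 by simp
      then have "t \<noteq> a" using m(2) by auto
      then show False using ns[OF t1] mq ta by simp
    qed
    obtain x y where xy: "int m = x * int q + y * int q'" "p = x * P + y * P'"
      by (rule unimodular)
    have drift: "g (c + e * m) - g c = real e * (x * D - y * D')"
    proof -
      have "g (c + e * m) - g c = \<sigma> * (h (c + e * m) - h c)" by (simp add: g_def algebra_simps)
      also have "\<dots> = real e * (\<sigma> * (real m * \<alpha> - (x * P + y * P')))" unfolding hd xy(2) by simp
      finally show ?thesis unfolding signed_error[OF xy(1)] .
    qed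
    define E where "E = \<bar>x * D - y * D'\<bar>"
    have eE: "real e * E < 1"
    proof -
      have "real e * E = \<bar>real e * (x * D - y * D')\<bar>" by (simp add: E_def abs_mult)
      then show ?thesis using g_close[of "c + e * m" c] drift by simp
    qed
    have qs: "int q > 0" "int q' > 0" using q by auto
    have mi: "int q < int m" "int m < int a * int q + int q'"
      using m by (simp, metis of_nat_add of_nat_less_iff of_nat_mult)
    have DD: "D < D'"
      using D q(3) mult_right_mono[of 1 "real a" D] by linarith
    have y0: "y \<noteq> 0"
    proof
      assume "y = 0"
      then have mx: "int m = x * int q" using xy by simp
      then have "1 * int q < x * int q" "x * int q < (int a + 1) * int q"
        using mi q by (simp_all add: algebra_simps)
      then have "1 < x" "x < int a + 1" unfolding mult_less_cancel_right_pos[OF qs(1)] by auto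
      moreover from this have "m = nat x * q" using mx by (metis int_nat_eq less_trans nat_int_comparison(1) of_nat_mult zero_less_one less_imp_le)
      ultimately show False using nm[of "nat x"] by linarith
    qed
    have y1: "y \<noteq> 1"
    proof
      assume "y = 1"
      then have mx: "int m = x * int q + int q'" using xy by simp
      then have "0 * int q < x * int q" "x * int q < int a * int q"
        using mi q by simp_all
      then have "0 < x" "x < int a" unfolding mult_less_cancel_right_pos[OF qs(1)] by auto
      moreover from this have "m = nat x * q + q'" using mx by (metis int_nat_eq nat_int_comparison(1) of_nat_mult of_nat_add less_imp_le)
      ultimately show False using ns[of "nat x"] by linarith
    qed
    consider "2 \<le> y" | "y \<le> -1" using y0 y1 by linarith
    then have cases: "(2 \<le> y \<and> 0 \<le> x + y - 2 \<and> x < int a \<and> E = y * D' - x * D \<and> (y - 1) * D' + D < E)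
        \<or> (y \<le> -1 \<and> 2 \<le> x \<and> E = x * D - y * D' \<and> - y * D' + D < E)"
    proof cases
      case 1
      have "1 * int q' < y * int q'" using 1 qs by (intro mult_strict_right_mono) auto
      then have "x * int q < int a * int q" using mi xy by linarith
      then have xa: "x < int a" unfolding mult_less_cancel_right_pos[OF qs(1)] by auto
      then have xD: "x * D \<le> (real a - 1) * D" using D(1) by (intro mult_right_mono) linarith+
      have "(y - 1) * D' > 0" using 1 D'_pos by simp
      then have E: "E = y * D' - x * D" "(y - 1) * D' + D < E"
        unfolding E_def using xD D by (auto simp: algebra_simps abs_if)
      have "0 \<le> x + y - 2"
      proof (rule ccontr)
        assume neg: "\<not> 0 \<le> x + y - 2"
        have "x * int q \<le> (1 - y) * int q" using neg qs by (intro mult_right_mono) auto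
        moreover have "y * int q' \<le> y * int q" using 1 q by (intro mult_left_mono) auto
        ultimately show False using mi xy by (simp add: algebra_simps)
      qed
      with 1 xa E show ?thesis by simp
    next
      case 2
      have "y * int q' \<le> (-1) * int q'" using 2 qs by (intro mult_right_mono) auto
      then have "1 * int q < x * int q" using mi xy qs by linarith
      then have x2: "2 \<le> x" unfolding mult_less_cancel_right_pos[OF qs(1)] by auto
      then have xD: "2 * D \<le> x * D" using D(1) by (intro mult_right_mono) auto
      have "real_of_int y * D' < 0" using 2 D'_pos by (simp add: mult_neg_pos)
      then have "0 < x * D - y * D'" using xD D(1) by linarith
      then have E: "E = x * D - y * D'" by (simp add: E_def)
      have "- y * D' + D < E" unfolding E using xD D(1) by simp
      then show ?thesis using 2 x2 E by simp
    qed
    have ED: "D' + D < E"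
    proof -
      have "1 * D' \<le> (y - 1) * D'" if "2 \<le> y" using that D'_pos by (intro mult_right_mono) auto
      moreover have "1 * D' \<le> - y * D'" if "y \<le> -1" using that D'_pos by (intro mult_right_mono) auto
      ultimately show ?thesis using cases by (elim disjE) auto
    qed
    \<comment> \<open>By \<open>det\<close>, \<open>q * (D' + D) \<ge> 1\<close>, so
      \<open>q\<close> blocks would drift too far.\<close>
    have eq: "e < q"
    proof (rule ccontr)
      assume "\<not> e < q"
      then have "real q * (D' + D) \<le> real e * E" using ED D D'_pos by (intro mult_mono) auto
      moreover have "real q' * D \<le> real q * D" using q D by (intro mult_right_mono) auto
      ultimately show False using eE det by (simp add: algebra_simps)
    qed
    then have q3: "3 \<le> q" "q = e + 1" using False e2 by auto
    have qe: "real q = real e + 1" using q3 by simp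
    \<comment> \<open>Now \<open>e = q - 1\<close>, so \<open>2 * e \<ge> q\<close> and
      \<open>e \<ge> q'\<close>; an error of \<open>2 * D' + D\<close> would drift by at least
      \<open>q * D' + q' * D = 1\<close>.\<close>
    have not2: "E < 2 * D' + D"
    proof (rule ccontr)
      assume "\<not> ?thesis"
      then have "real e * (2 * D' + D) \<le> real e * E" by (intro mult_left_mono) auto
      moreover have "real q * D' \<le> 2 * real e * D'" using qe e2 D'_pos by (intro mult_right_mono) auto
      moreover have "real q' * D \<le> real e * D" using q q3 D by (intro mult_right_mono) auto
      ultimately show False using eE det by (simp add: algebra_simps)
    qed
    consider (low) "y = 2" | (high) "y = -1"
    proof -
      have "2 * D' \<le> (y - 1) * D'" if "3 \<le> y" using that D'_pos by (intro mult_right_mono) auto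
      moreover have "2 * D' \<le> - y * D'" if "y \<le> -2" using that D'_pos by (intro mult_right_mono) auto
      ultimately have "\<not> 3 \<le> y" "\<not> y \<le> -2" using cases not2 by auto
      then show thesis using that cases by linarith
    qed
    then show ?thesis
    proof cases
      case low
      then have x: "0 \<le> x" "x < int a" "E = 2 * D' - x * D" using cases by auto
      obtain l where l: "x = int l" using x(1) nonneg_int_cases by blast
      have "int m = int (l * q + 2 * q')" using xy(1) low l by simp
      then have ml: "m = l * q + 2 * q'" by (simp only: of_nat_eq_iff)
      have dr: "g (c + e * m) = g c - real e * (2 * D' - real l * D)"
        using drift low l by (simp add: algebra_simps)
      show ?thesis
      proof (cases "l = 0")
        case False
        then have "abelian_period (map s [0..<L]) (l * q + q')"
          using x(2) l by (intro abelian_period_semiconvergent[OF _ _ ml c r e2 L dr]) auto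
        then show ?thesis using ml q by (intro exI[of _ "l * q + q'"]) auto
      next
        case True
        have m2: "m = 2 * q'" using ml True by simp
        \<comment> \<open>The \<open>e\<close> blocks lower \<open>g\<close> by almost 1, so no
          value of \<open>g\<close> reaches \<open>g c + D\<close>.\<close>
        have late: "1 - real e * (2 * D') \<le> D"
        proof -
          have "(real q' - 1) * D \<le> (real q - 2) * D'" using q q3 DD D by (intro mult_mono) auto
          then show ?thesis using det qe by (simp add: algebra_simps)
        qed
        \<comment> \<open>The value of \<open>g\<close> at a hit before \<open>c\<close> would be
          within \<open>D\<close> of \<open>g c\<close>, which \<open>gap\<close> forbids as
          \<open>c < m < a * q + q'\<close>. This permits \<open>lo = c\<close>.\<close>
        have none: "\<not> hit 1 i" if "i < c" for i
        proof
          assume hit: "hit 1 i"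
          have "g (i + q) = g i + D - 1" using hit_eq[OF _ _ hit] q(3) by simp
          then have "g c < g i + D" using g_close[of c "i + q"] by linarith
          moreover have "g i < g c + D" using g_close[of i "c + e * m"] dr late True by simp
          ultimately have "i + (a * q + q') \<le> c" using gap[OF that] by simp
          then show False using c m(2) by linarith
        qed
        have "L < q + c + (q - 1) * (a * q + q')"
        proof -
          have "L < c + q * (2 * q')" using L r q3(2) m2 by simp
          moreover have "q * (2 * q') \<le> q + (q - 1) * (1 * q + q')"
          proof -
            have "q * (q' + 1) \<le> q * q" using q by (intro mult_left_mono) auto
            moreover have "(q - 1) * (1 * q + q') + (q + q') = q * q + q * q'"
              using q3(2) by (simp add: algebra_simps)
            ultimately show ?thesis using q by (simp add: algebra_simps)
          qed
          moreover have "(q - 1) * (1 * q + q') \<le> (q - 1) * (a * q + q')"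
            using q by (intro mult_left_mono add_mono mult_right_mono) auto
          ultimately show ?thesis by linarith
        qed
        then have "abelian_period (map s [0..<L]) (1 * q)"
          using q(3) none m mL by (intro abelian_period_multiple[where lo = c]) auto
        then show ?thesis using m by auto
      qed
    next
      case high
      then have x: "2 \<le> x" "E = x * D + D'" using cases by auto
      have mx: "int m = x * int q - int q'" using xy(1) high by simp
      \<comment> \<open>Combining \<open>e * E < 1\<close>, \<open>det\<close> and
        \<open>D' < (a + 1) * D\<close> shows that \<open>a\<close> is large compared with
        \<open>x\<close>, so the windows are long compared with \<open>m\<close>.\<close>
      have ax: "x * (int q - 1) - int q' \<le> int a"
      proof -
        have "real e * D' + real e * (x * D) < real q * D' + real q' * D"
          using eE det x(2) by (simp add: algebra_simps)
        then have "(real e * x - real q') * D < (real a + 1) * D" using D qe by (simp add: algebra_simps)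
        then have "real e * x - real q' < real a + 1" unfolding mult_less_cancel_right_pos[OF D(1)] by auto
        then have "real_of_int (int e * x - int q') < real_of_int (int a + 1)" by simp
        then have "int e * x - int q' < int a + 1" by (simp only: of_int_less_iff)
        then show ?thesis using q3(2) by (simp add: algebra_simps)
      qed
      obtain u where u: "x = int u + 1" "1 \<le> u"
      proof (rule that)
        show "x = int (nat (x - 1)) + 1" "1 \<le> nat (x - 1)" using x(1) by auto
      qed
      have "int u * int q < (int a + 1) * int q"
        using mx mi q u by (simp add: algebra_simps)
      then have ua: "u \<le> a" unfolding mult_less_cancel_right_pos[OF qs(1)] by auto
      have "int (u * q) < int m" using mx u q by (simp add: algebra_simps)
      then have um: "u * q < m" by (simp only: of_nat_less_iff)
      have "int L < int (u * q + 0 + (q - 1) * (a * q + q'))"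
      proof -
        define Q where "Q = int q"
        \<comment> \<open>After inserting \<open>ax\<close>, the right side exceeds the bound on
          \<open>L + 2\<close> by at least \<open>x * Q * K - q' * (K - 1) - Q\<close>. This is at
          least \<open>Q * K\<close> because \<open>x \<ge> 2\<close> and \<open>q' \<le> Q\<close>;
          and \<open>Q \<ge> 3\<close> gives \<open>K \<ge> 1\<close>.\<close>
        define K where "K = Q * Q - 3 * Q + 1"
        have "3 * Q \<le> Q * Q" using q3 by (intro mult_right_mono) (auto simp: Q_def)
        then have K: "1 \<le> K" by (simp add: K_def)
        have "int L + 2 \<le> (Q + 1) * int m"
          using L c r q3(2) by (simp add: Q_def algebra_simps flip: of_nat_add of_nat_mult)
        then have 1: "int L + 2 \<le> (Q + 1) * (x * Q - int q')" using mx by (simp add: Q_def)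
        have 2: "(2 * Q) * K \<le> (x * Q) * K" using x K qs by (intro mult_right_mono) (auto simp: Q_def)
        have 3: "int q' * (K - 1) \<le> Q * (K - 1)" using q K by (intro mult_right_mono) (auto simp: Q_def)
        have 4: "((Q - 1) * Q) * (x * (Q - 1) - int q') \<le> ((Q - 1) * Q) * int a"
          using ax q3 by (intro mult_left_mono) (auto simp: Q_def)
        have 5: "0 \<le> Q * K" using K by (simp add: Q_def)
        have "int L < (x - 1) * Q + (Q - 1) * (int a * Q + int q')"
          using 1 2 3 4 5 by (simp add: K_def algebra_simps)
        also have "(x - 1) * Q + (Q - 1) * (int a * Q + int q') = int (u * q + 0 + (q - 1) * (a * q + q'))"
          using q3 u by (simp add: Q_def of_nat_diff algebra_simps)
        finally show ?thesis .
      qed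
      then have "L < u * q + 0 + (q - 1) * (a * q + q')" by (simp only: of_nat_less_iff)
      then have "abelian_period (map s [0..<L]) (u * q)"
        using um mL by (intro abelian_period_multiple[OF u(2) ua, where lo = 0]) auto
      then show ?thesis using um by blast
    qed
  qed
qed

end

section \<open>Minimal abelian periods of factors\<close>

theorem theorem1p4:
  fixes \<alpha> :: real and s :: "nat \<Rightarrow> nat" and w :: "nat list" and m :: nat
  assumes "0 < \<alpha>" and "\<alpha> < 1/2" and "\<alpha> \<notin> \<rat>"
    and "sturmian_word \<alpha> s" and "factor_of w s" and "w \<noteq> []"
    and "min_abelian_period w m"
  shows "(\<exists>k t. 1 \<le> t \<and> t \<le> cf_a \<alpha> (k + 1) \<and> m = t * cf_q \<alpha> k)
       \<or> (\<exists>k l. 1 \<le> k \<and> 1 \<le> l \<and> l < cf_a \<alpha> (k + 1) \<and> m = l * cf_q \<alpha> k + cf_q \<alpha> (k - 1))"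
proof -
  obtain h0 where "coding \<alpha> s h0"
    using sturmian_word_coding[of \<alpha> s] assms by auto
  moreover obtain i where w: "w = map s [i..<i + length w]"
    using assms(5) by (auto simp: factor_of_def)
  moreover have "map s [i..<i + n] = map (\<lambda>j. s (i + j)) [0..<n]" for n
    by (rule nth_equalityI) auto
  ultimately obtain v h where cod: "coding \<alpha> v h" and wv: "w = map v [0..<length w]"
    using coding_shift[of \<alpha> s h0 i] by metis
  have per: "abelian_period (map v [0..<length w]) m"
    and least: "\<And>M. abelian_period (map v [0..<length w]) M \<Longrightarrow> m \<le> M"
    using assms(7) unfolding min_abelian_period_def wv[symmetric] by auto
  have m1: "1 \<le> m" by (rule abelian_periodE[OF cod per]) simp
  have conv: "\<exists>\<sigma> P P' D D'. convergents \<alpha> \<sigma> D D' (cf_q \<alpha> (Suc k)) (cf_q \<alpha> k) (cf_a \<alpha> (k + 2)) P P'" for k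
    using convergents_cf[OF assms(1-3), of k] by blast
  have inc: "cf_q \<alpha> k < cf_q \<alpha> (Suc k)" for k
    using conv[of k] convergents.q(2) by blast
  have "k < cf_q \<alpha> k" for k
  proof (induction k)
    case (Suc k)
    then show ?case using inc[of k] by linarith
  qed simp
  \<comment> \<open>The least such \<open>n\<close> is the successor of the index \<open>k\<close>
    whose denominator is the last one not exceeding \<open>m\<close>.\<close>
  then obtain n where n: "m < cf_q \<alpha> n" "\<And>j. j < n \<Longrightarrow> \<not> m < cf_q \<alpha> j"
    using exists_least_iff[of "\<lambda>n. m < cf_q \<alpha> n"] by blast
  then obtain k where nk: "n = Suc k" using m1 by (cases n) auto
  have mk: "cf_q \<alpha> k \<le> m" using n(2)[of k] nk by simp
  show ?thesis
  proof (cases k)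
    case 0
    \<comment> \<open>The denominator of index 0 is 1, so \<open>m < cf_a \<alpha> 1\<close> is
      itself the multiplier.\<close>
    then show ?thesis using n(1) nk m1 by (intro disjI1 exI[of _ 0] exI[of _ m]) simp
  next
    case (Suc k')
    obtain \<sigma> P P' D D' where cv: "convergents \<alpha> \<sigma> D D' (cf_q \<alpha> k) (cf_q \<alpha> k') (cf_a \<alpha> (k + 1)) P P'"
      using conv[of k'] Suc by auto
    interpret coded_convergents \<alpha> \<sigma> D D' "cf_q \<alpha> k" "cf_q \<alpha> k'" "cf_a \<alpha> (k + 1)" P P' v h
      using cv cod by (simp add: coded_convergents_def coded_convergents_axioms_def)
    have up: "m < cf_a \<alpha> (k + 1) * cf_q \<alpha> k + cf_q \<alpha> k'" using n(1) unfolding nk Suc by simp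
    show ?thesis
    proof (rule ccontr)
      assume no: "\<not> ?thesis"
      have nm: "m \<noteq> t * cf_q \<alpha> k" if "1 \<le> t" "t \<le> cf_a \<alpha> (k + 1)" for t using no that by blast
      have ns: "m \<noteq> l * cf_q \<alpha> k + cf_q \<alpha> k'" if "1 \<le> l" "l < cf_a \<alpha> (k + 1)" for l
        using no that Suc by (metis One_nat_def diff_Suc_1 le_add1 plus_1_eq_Suc)
      have "cf_q \<alpha> k < m" using mk nm[of 1] q(3) by (simp add: le_neq_implies_less)
      from shorter_abelian_period[OF this up nm ns per] least show False by (meson not_le)
    qed
  qed
qed

end
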